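(* For every integer $k\ge 1$ and every integer $n\ge 0$, $$r_n(1,-q^k)=(q;q)_n\sum_{\substack{j,\ell\ge 0\\ j+2\ell=n}}q^{\binom{j}{2}}\begin{bmatrix}k\\ j\end{bmatrix}\frac{1}{(q^2;q^2)_\ell}.$$
   Context: Here $q$ is an indeterminate and identities are in the field $\mathbb{Q}(q)$. For integers $n,k\ge0$ the $q$-binomial coefficient is $\begin{bmatrix}n\\k\end{bmatrix}=\frac{(1-q^{n-k+1})\cdots(1-q^n)}{(1-q)\cdots(1-q^k)}$ (equal to $1$ for $k=0$ and $0$ for $k>n$). The Rogers-Szegö polynomials are $r_n(x,a)=\sum_{k=0}^{n}\begin{bmatrix}n\\k\end{bmatrix}x^k a^{n-k}$. The $q$-Pochhammer symbols are $(q;q)_n=\prod_{i=1}^{n}(1-q^i)$ and $(q^2;q^2)_\ell=\prod_{i=1}^{\ell}(1-q^{2i})$, with empty products equal to $1$. *)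

theory Defs
  imports "HOL-Computational_Algebra.Computational_Algebra"
begin

type_synonym ratfun = "rat poly fract"

definition q :: ratfun where
  "q = to_fract [:0, 1:]"

text \<open>The case distinction keeps the natural-number subtraction in the exponent
  \<open>n - k + i\<close> from truncating.\<close>

definition q_binomial :: "nat \<Rightarrow> nat \<Rightarrow> ratfun" where
  "q_binomial n k =
     (if k > n then 0 else (\<Prod>i=1..k. 1 - q ^ (n - k + i)) / (\<Prod>i=1..k. 1 - q ^ i))"

definition rogers_szego :: "nat \<Rightarrow> ratfun \<Rightarrow> ratfun \<Rightarrow> ratfun" where
  "rogers_szego n x a = (\<Sum>k=0..n. q_binomial n k * x ^ k * a ^ (n - k))"

text \<open>The diagonal \<open>q\<close>-Pochhammer symbol \<open>(z; z)\<^sub>n\<close>, used for \<open>z = q\<close> and \<open>z = q\<^sup>2\<close>.\<close>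

definition q_pochhammer :: "ratfun \<Rightarrow> nat \<Rightarrow> ratfun" where
  "q_pochhammer z n = (\<Prod>i=1..n. 1 - z ^ i)"

end

theory Submission
  imports Defs
begin

text \<open>
  The identity compares coefficients of \<open>X\<^sup>n\<close> in a product of formal power series over
  \<open>\<rat>(q)\<close>.  Let \<open>e\<^sub>c(X) = \<Sum>\<^sub>n c\<^sup>n X\<^sup>n / (q; q)\<^sub>n\<close>, which is \<open>1 / (cX; q)\<^sub>\<infinity>\<close> by Euler;
  only the functional equation \<open>e\<^bsub>cq\<^esub>(X) = (1 - cX) e\<^sub>c(X)\<close> (lemma \<open>qexp_shift\<close>) enters,
  so no infinite product has to be defined.  Since
  \<open>[n, k] = (q; q)\<^sub>n / ((q; q)\<^sub>k (q; q)\<^bsub>n-k\<^esub>)\<close>, the series \<open>e\<^sub>x e\<^sub>a\<close> generates the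
  Rogers-Szego polynomials \<open>r\<^sub>n(x, a) / (q; q)\<^sub>n\<close> (lemma \<open>rogers_szego_qexp\<close>).

  Take \<open>x = 1\<close> and \<open>a = -q\<^sup>k\<close>.  Applying the functional equation \<open>k\<close> times gives
  \<open>e\<^sub>1 e\<^sub>a = (\<Prod>\<^bsub>i<k\<^esub> (1 + q\<^sup>i X)) \<cdot> e\<^sub>1 e\<^bsub>-1\<^esub>\<close>.  The finite product expands by the
  \<open>q\<close>-binomial theorem (lemma \<open>q_binomial_theorem\<close>) and supplies the terms indexed by \<open>j\<close>.
  The remaining factor is \<open>1 / (X\<^sup>2; q\<^sup>2)\<^sub>\<infinity>\<close>, because \<open>(1 - X)(1 + X) = 1 - X\<^sup>2\<close>;
  its coefficients \<open>1 / (q\<^sup>2; q\<^sup>2)\<^sub>l\<close> at \<open>X\<^bsup>2l\<^esup>\<close> follow from the functional equation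
  (lemma \<open>qexp_even_nth\<close>) and supply the terms indexed by \<open>l\<close>.
\<close>

section \<open>Pochhammer symbols and binomial coefficients\<close>

lemma q_power_ne_1:
  assumes "n > 0"
  shows "q ^ n \<noteq> 1"
proof
  assume "q ^ n = 1"
  moreover have "q ^ n = to_fract ([:0, 1:] ^ n)"
    unfolding q_def by (induction n) (simp_all add: to_fract_mult [symmetric] del: to_fract_mult)
  ultimately have "to_fract ([:0, 1:] ^ n :: rat poly) = to_fract 1"
    by simp
  then have "[:0, 1:] ^ n = (1 :: rat poly)"
    by (simp only: to_fract_eq_iff)
  then have "degree ([:0, 1:] ^ n :: rat poly) = 0"
    by simp
  then show False
    using assms by (simp add: degree_power_eq)
qed

lemma q_pochhammer_0 [simp]: "q_pochhammer z 0 = 1"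
  by (simp add: q_pochhammer_def)

lemma q_pochhammer_Suc: "q_pochhammer z (Suc n) = q_pochhammer z n * (1 - z ^ Suc n)"
  by (simp add: q_pochhammer_def)

lemma q_pochhammer_nz [simp]: "q_pochhammer q n \<noteq> 0"
proof (induction n)
  case (Suc n)
  then show ?case
    using q_power_ne_1[of "Suc n"] by (simp add: q_pochhammer_Suc del: power_Suc)
qed simp

lemma q_pochhammer_add:
  "q_pochhammer z (m + k) = q_pochhammer z m * (\<Prod>i=1..k. 1 - z ^ (m + i))"
  by (induction k) (simp_all add: q_pochhammer_Suc mult.assoc del: power_Suc)

lemma q_binomial_eq:
  assumes "k \<le> n"
  shows "q_binomial n k = q_pochhammer q n / (q_pochhammer q k * q_pochhammer q (n - k))"
  using q_pochhammer_add[of q "n - k" k] assms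
  by (simp add: q_binomial_def q_pochhammer_def [of q k])

lemma q_binomial_0 [simp]: "q_binomial n 0 = 1"
  by (simp add: q_binomial_def)

lemma q_binomial_eq_0 [simp]: "k > n \<Longrightarrow> q_binomial n k = 0"
  by (simp add: q_binomial_def)

text \<open>Of the two \<open>q\<close>-Pascal rules, this is the one matching the factor \<open>1 + q\<^sup>k X\<close> appended
  last in the \<open>q\<close>-binomial theorem: multiplied by \<open>q\<^bsup>j(j+1)/2\<^esup>\<close>, its second term becomes
  \<open>q\<^sup>k\<close> times the previous coefficient.\<close>

lemma q_pascal:
  assumes "j \<le> k"
  shows "q_binomial (Suc k) (Suc j) = q_binomial k (Suc j) + q ^ (k - j) * q_binomial k j"
proof (cases "j = k")
  case True
  then show ?thesis by (simp add: q_binomial_eq)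
next
  case False
  with assms obtain d where k: "k = Suc (j + d)"
    using less_imp_Suc_add by (metis le_neq_implies_less)
  have nz: "1 - q ^ Suc j \<noteq> 0" "1 - q ^ Suc d \<noteq> 0"
    using q_power_ne_1[of "Suc j"] q_power_ne_1[of "Suc d"] by auto
  have split: "1 - q ^ (Suc k) = (1 - q ^ Suc d) + q ^ Suc d * (1 - q ^ Suc j)"
    by (simp add: k algebra_simps power_add)
  have "q_binomial (Suc k) (Suc j) = q_pochhammer q k * (1 - q ^ Suc k) /
       (q_pochhammer q j * (1 - q ^ Suc j) * (q_pochhammer q d * (1 - q ^ Suc d)))"
    by (simp add: q_binomial_eq k q_pochhammer_Suc Suc_diff_le del: power_Suc)
  also have "\<dots> = q_pochhammer q k / (q_pochhammer q j * (1 - q ^ Suc j) * q_pochhammer q d)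
       + q ^ Suc d * (q_pochhammer q k / (q_pochhammer q j * (q_pochhammer q d * (1 - q ^ Suc d))))"
    unfolding split using nz
    by (simp add: add_divide_distrib distrib_left mult_ac del: power_Suc)
  also have "\<dots> = q_binomial k (Suc j) + q ^ (k - j) * q_binomial k j"
    by (simp add: q_binomial_eq k q_pochhammer_Suc Suc_diff_le del: power_Suc)
  finally show ?thesis .
qed

section \<open>The \<open>q\<close>-binomial theorem\<close>

lemma fps_linear_mult_nth:
  fixes F :: "'a :: comm_ring_1 fps"
  shows "((1 + fps_const c * fps_X) * F) $ n = F $ n + (if n = 0 then 0 else c * F $ (n - 1))"
  by (simp add: distrib_right mult.assoc)

lemma q_binomial_theorem:
  "(\<Prod>i<k. 1 + fps_const (q ^ i) * fps_X) = Abs_fps (\<lambda>j. q ^ (j choose 2) * q_binomial k j)"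
proof (induction k)
  case 0
  have "q_binomial 0 j = (if j = 0 then 1 else 0)" for j
    by simp
  then show ?case
    by (intro fps_ext) (simp add: binomial_eq_0)
next
  case (Suc k)
  let ?B = "\<lambda>k. Abs_fps (\<lambda>j. q ^ (j choose 2) * q_binomial k j)"
  have "((1 + fps_const (q ^ k) * fps_X) * ?B k) $ j = ?B (Suc k) $ j" for j
  proof (cases j)
    case 0
    then show ?thesis by (simp add: fps_linear_mult_nth binomial_eq_0)
  next
    case (Suc m)
    show ?thesis
    proof (cases "m \<le> k")
      case True
      have "Suc m choose 2 = m + (m choose 2)"
        by (simp add: numeral_2_eq_2)
      moreover from True have "q ^ k = q ^ m * q ^ (k - m)"
        by (simp flip: power_add)
      ultimately show ?thesis
        using True
        by (simp add: Suc fps_linear_mult_nth q_pascal power_add algebra_simps)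
    qed (simp add: Suc fps_linear_mult_nth)
  qed
  then have "(1 + fps_const (q ^ k) * fps_X) * ?B k = ?B (Suc k)"
    by (rule fps_ext)
  then show ?case
    by (simp only: Suc.IH prod.lessThan_Suc mult.commute[of "Abs_fps _"])
qed

section \<open>The \<open>q\<close>-exponential series\<close>

text \<open>Euler's series \<open>1 / (cX; q)\<^sub>\<infinity>\<close>.\<close>

definition qexp :: "ratfun \<Rightarrow> ratfun fps" where
  "qexp c = Abs_fps (\<lambda>n. c ^ n / q_pochhammer q n)"

text \<open>The form of \<open>(cqX; q)\<^sub>\<infinity> (1 - cX) = (cX; q)\<^sub>\<infinity>\<close> that needs no infinite product:
  coefficientwise it is \<open>1 / (q; q)\<^bsub>n-1\<^esub> = (1 - q\<^sup>n) / (q; q)\<^sub>n\<close>.\<close>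

lemma qexp_shift: "qexp (c * q) = (1 + fps_const (- c) * fps_X) * qexp c"
proof (intro fps_ext)
  fix n
  show "qexp (c * q) $ n = ((1 + fps_const (- c) * fps_X) * qexp c) $ n"
  proof (cases n)
    case (Suc m)
    have "1 - q ^ Suc m \<noteq> 0"
      using q_power_ne_1[of "Suc m"] by simp
    then have "(c * q) ^ Suc m / q_pochhammer q (Suc m)
        = c ^ Suc m / q_pochhammer q (Suc m) + - c * (c ^ m / q_pochhammer q m)"
      by (simp add: q_pochhammer_Suc power_mult_distrib divide_simps del: power_Suc)
         (simp add: algebra_simps)
    then show ?thesis
      by (simp only: Suc fps_linear_mult_nth) (simp add: qexp_def)
  qed (simp add: qexp_def fps_linear_mult_nth)
qed

lemma rogers_szego_qexp: "rogers_szego n x a = q_pochhammer q n * (qexp x * qexp a) $ n"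
  unfolding rogers_szego_def fps_mult_nth sum_distrib_left
  by (intro sum.cong) (simp_all add: qexp_def q_binomial_eq)

lemma qexp_mult_scale: "(qexp (a * c) * qexp (b * c)) $ n = c ^ n * (qexp a * qexp b) $ n"
  unfolding fps_mult_nth sum_distrib_left
proof (intro sum.cong refl)
  fix i assume "i \<in> {0..n}"
  then have "c ^ n = c ^ i * c ^ (n - i)"
    by (simp flip: power_add)
  then show "qexp (a * c) $ i * qexp (b * c) $ (n - i) = c ^ n * (qexp a $ i * qexp b $ (n - i))"
    by (simp add: qexp_def power_mult_distrib)
qed

text \<open>The series \<open>F = e\<^sub>1 e\<^bsub>-1\<^esub>\<close> satisfies \<open>F(qX) = (1 - X\<^sup>2) F(X)\<close>.  Hence
  \<open>(1 - q\<^sup>n) F\<^sub>n = F\<^bsub>n-2\<^esub>\<close>, which determines all coefficients from \<open>F\<^sub>0 = 1\<close>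
  and \<open>F\<^sub>1 = 0\<close>.\<close>

lemma qexp_even_nth:
  "(qexp 1 * qexp (-1)) $ n = (if even n then 1 / q_pochhammer (q ^ 2) (n div 2) else 0)"
proof (induction n rule: less_induct)
  case (less n)
  define F where "F = qexp 1 * qexp (-1)"
  have "qexp (1 * q) * qexp (-1 * q)
      = (1 + fps_const (-1) * fps_X) * ((1 + fps_const 1 * fps_X) * F)"
    unfolding qexp_shift F_def minus_minus by (simp only: mult_ac)
  then have step: "q ^ m * F $ m
      = ((1 + fps_const (-1) * fps_X) * ((1 + fps_const 1 * fps_X) * F)) $ m" for m
    by (metis qexp_mult_scale F_def)
  consider "n = 0" | "n = 1" | m where "n = Suc (Suc m)"
    by (metis One_nat_def not0_implies_Suc)
  then show ?case
  proof cases
    case 1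
    then show ?thesis by (simp add: qexp_def)
  next
    case 2
    then show ?thesis by (simp add: qexp_def fps_mult_nth)
  next
    case 3
    have nz: "1 - q ^ n \<noteq> 0"
      using q_power_ne_1[of n] 3 by simp
    have "q ^ n * F $ n = F $ n - F $ m"
      using step[of n] 3 by (simp only: fps_linear_mult_nth) (simp add: fps_linear_mult_nth)
    then have "F $ n = F $ m / (1 - q ^ n)"
      using nz by (simp add: field_simps)
    moreover have "F $ m = (if even m then 1 / q_pochhammer (q ^ 2) (m div 2) else 0)"
      using less[of m] 3 by (simp add: F_def)
    moreover have "q_pochhammer (q ^ 2) (n div 2) = q_pochhammer (q ^ 2) (m div 2) * (1 - q ^ n)"
      if "even m"
    proof -
      have "(q ^ 2) ^ Suc (m div 2) = q ^ n"
        unfolding power_mult [symmetric] using that 3 by (intro arg_cong[of _ _ "(^) q"]) auto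
      then show ?thesis
        using 3 by (simp add: q_pochhammer_Suc del: power_Suc)
    qed
    ultimately show ?thesis
      using 3 by (simp add: F_def)
  qed
qed

lemma qexp_neg_q_power:
  "qexp (- (q ^ k)) = (\<Prod>i<k. 1 + fps_const (q ^ i) * fps_X) * qexp (-1)"
proof (induction k)
  case (Suc k)
  have "qexp (- (q ^ Suc k)) = (1 + fps_const (q ^ k) * fps_X) * qexp (- (q ^ k))"
    using qexp_shift[of "- (q ^ k)"] by (simp add: mult.commute)
  then show ?case
    by (simp only: Suc.IH prod.lessThan_Suc mult_ac)
qed simp

section \<open>The coefficient comparison\<close>

text \<open>A convolution against a series in \<open>X\<^sup>2\<close> only sees the indices \<open>j\<close> for which \<open>n - j\<close>
  is even, that is, \<open>n - j = 2 * l\<close>.\<close>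

lemma sum_even_complement:
  fixes f g :: "nat \<Rightarrow> 'a :: comm_ring_1"
  shows "(\<Sum>j=0..n. f j * (if even (n - j) then g ((n - j) div 2) else 0))
       = (\<Sum>(j, l) \<in> {(j, l). j + 2 * l = n}. f j * g l)"
proof -
  have "(\<Sum>j=0..n. f j * (if even (n - j) then g ((n - j) div 2) else 0))
      = (\<Sum>j \<in> {j \<in> {0..n}. even (n - j)}. f j * g ((n - j) div 2))"
    by (subst sum.inter_filter) (auto intro!: sum.cong)
  also have "\<dots> = (\<Sum>(j, l) \<in> {(j, l). j + 2 * l = n}. f j * g l)"
    by (rule sum.reindex_bij_witness[of _ fst "\<lambda>j. (j, (n - j) div 2)"]) auto
  finally show ?thesis .
qed

theorem mainTheorem3:
  fixes k n :: nat
  assumes "k \<ge> 1"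
  shows "rogers_szego n 1 (- (q ^ k)) =
    q_pochhammer q n *
      (\<Sum>(j, l) \<in> {(j, l). j + 2 * l = n}.
         q ^ (j choose 2) * q_binomial k j * (1 / q_pochhammer (q ^ 2) l))"
proof -
  have "qexp 1 * qexp (- (q ^ k))
      = Abs_fps (\<lambda>j. q ^ (j choose 2) * q_binomial k j) * (qexp 1 * qexp (-1))"
    unfolding qexp_neg_q_power q_binomial_theorem by (simp only: mult_ac)
  then have "(qexp 1 * qexp (- (q ^ k))) $ n
      = (\<Sum>j=0..n. q ^ (j choose 2) * q_binomial k j *
           (if even (n - j) then 1 / q_pochhammer (q ^ 2) ((n - j) div 2) else 0))"
    by (simp only: fps_mult_nth [of "Abs_fps _"] qexp_even_nth fps_nth_Abs_fps)
  also have "\<dots> = (\<Sum>(j, l) \<in> {(j, l). j + 2 * l = n}.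
         q ^ (j choose 2) * q_binomial k j * (1 / q_pochhammer (q ^ 2) l))"
    by (rule sum_even_complement)
  finally show ?thesis
    by (simp only: rogers_szego_qexp)
qed

end
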